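(* Let $0<\lambda<\mu<1$ with $\lambda+\mu>1$. If $\lambda\mu\ge 2^{-1/6}$, then $A_{\lambda,\mu}$ has non-empty interior (as a subset of $\mathbb{R}^2$).
   Context: For $0<\lambda<\mu<1$ with $\lambda+\mu>1$, define maps of the plane $$T_0(x,y)=(\lambda x,\mu y),\qquad T_1(x,y)=(\mu x+1-\mu,\ \lambda y+1-\lambda),$$ and let $A_{\lambda,\mu}$ be the attractor of the iterated function system $\{T_0,T_1\}$, i.e. the unique non-empty compact set $A\subset\mathbb{R}^2$ with $A=T_0(A)\cup T_1(A)$. *)

theory Defs
  imports "HOL-Analysis.Analysis"
begin

definition T0 :: "real \<Rightarrow> real \<Rightarrow> real \<times> real \<Rightarrow> real \<times> real" where
  "T0 l m = (\<lambda>(x, y). (l * x, m * y))"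

definition T1 :: "real \<Rightarrow> real \<Rightarrow> real \<times> real \<Rightarrow> real \<times> real" where
  "T1 l m = (\<lambda>(x, y). (m * x + 1 - m, l * y + 1 - l))"

definition is_attractor :: "real \<Rightarrow> real \<Rightarrow> (real \<times> real) set \<Rightarrow> bool" where
  "is_attractor l m A \<longleftrightarrow> A \<noteq> {} \<and> compact A \<and> A = T0 l m ` A \<union> T1 l m ` A"

text \<open>The description below is proper whenever both parameters lie in (0,1);
  see \<open>ex1_attractor\<close>.\<close>

definition attractor :: "real \<Rightarrow> real \<Rightarrow> (real \<times> real) set" where
  "attractor l m = (THE A. is_attractor l m A)"

lemma dist_scale_le:
  fixes a b c :: real
  assumes "0 \<le> a" "a \<le> c" "0 \<le> b" "b \<le> c"
  shows "dist (a * x + u, b * y + v) (a * x' + u, b * y' + v) \<le> c * dist (x, y) (x', y')"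
proof -
  have "(a * (x - x'))\<^sup>2 + (b * (y - y'))\<^sup>2 \<le> c\<^sup>2 * ((x - x')\<^sup>2 + (y - y')\<^sup>2)"
    using assms by (auto simp: power_mult_distrib distrib_left intro!: add_mono mult_right_mono power_mono)
  then have "sqrt ((a * (x - x'))\<^sup>2 + (b * (y - y'))\<^sup>2) \<le> sqrt (c\<^sup>2 * ((x - x')\<^sup>2 + (y - y')\<^sup>2))"
    by (rule real_sqrt_le_mono)
  also have "\<dots> = c * sqrt ((x - x')\<^sup>2 + (y - y')\<^sup>2)"
    using assms by (simp add: real_sqrt_mult)
  finally show ?thesis
    by (simp add: dist_prod_def dist_real_def right_diff_distrib)
qed

lemma T_contraction:
  assumes "0 < l" "l < 1" "0 < m" "m < 1"
  shows "dist (T0 l m p) (T0 l m q) \<le> max l m * dist p q"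
    and "dist (T1 l m p) (T1 l m q) \<le> max l m * dist p q"
proof -
  obtain x y x' y' where pq: "p = (x, y)" "q = (x', y')" by fastforce
  show "dist (T0 l m p) (T0 l m q) \<le> max l m * dist p q"
    using dist_scale_le[of l "max l m" m x 0 y 0 x' y'] assms by (simp add: pq T0_def)
  show "dist (T1 l m p) (T1 l m q) \<le> max l m * dist p q"
    using dist_scale_le[of m "max l m" l x "1 - m" y "1 - l" x' y'] assms
    by (simp add: pq T1_def algebra_simps)
qed

lemma attractor_subset:
  assumes lm: "0 < l" "l < 1" "0 < m" "m < 1"
    and A: "is_attractor l m A" and B: "is_attractor l m B"
  shows "A \<subseteq> B"
proof -
  let ?c = "max l m"
  have c: "0 < ?c" "?c < 1" using lm by auto
  have Ane: "A \<noteq> {}" and Ac: "compact A" and Aeq: "A = T0 l m ` A \<union> T1 l m ` A"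
    and Bne: "B \<noteq> {}" and Bc: "compact B" and Beq: "B = T0 l m ` B \<union> T1 l m ` B"
    using A B by (simp_all add: is_attractor_def)
  have "continuous_on A (\<lambda>p. infdist p B)"
    by (intro continuous_intros)
  then obtain p where p: "p \<in> A" and pmax: "\<And>q. q \<in> A \<Longrightarrow> infdist q B \<le> infdist p B"
    using continuous_attains_sup[OF Ac Ane] by blast
  have "\<exists>q\<in>A. p = T0 l m q \<or> p = T1 l m q" using p Aeq by blast
  then obtain q where q: "q \<in> A" "p = T0 l m q \<or> p = T1 l m q" by blast
  obtain b where b: "b \<in> B" "infdist q B = dist q b"
    using infdist_attains_inf[OF compact_imp_closed[OF Bc] Bne] by blast
  have tb: "T0 l m b \<in> B" "T1 l m b \<in> B" using b(1) Beq by blast+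
  have "infdist p B \<le> ?c * dist q b"
    using q(2) T_contraction[OF lm, of q b] infdist_le2[OF tb(1)] infdist_le2[OF tb(2)] by blast
  also have "\<dots> \<le> ?c * infdist p B"
    using pmax[OF q(1)] b(2) c by (intro mult_left_mono) auto
  finally have "(1 - ?c) * infdist p B \<le> 0" by (simp add: algebra_simps)
  then have "infdist p B \<le> 0" using c by (simp add: mult_le_0_iff)
  then have "\<And>a. a \<in> A \<Longrightarrow> infdist a B = 0"
    using pmax infdist_nonneg by (meson order_antisym order_trans)
  then show ?thesis
    using in_closed_iff_infdist_zero[OF compact_imp_closed[OF Bc] Bne] by blast
qed

lemma attractor_exists:
  assumes lm: "0 < l" "l < 1" "0 < m" "m < 1"
  shows "\<exists>A. is_attractor l m A"
proof -
  define F where "F X = T0 l m ` X \<union> T1 l m ` X" for X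
  define K where "K n = (F ^^ n) ({0..1} \<times> {0..1})" for n
  define A where "A = (\<Inter>n. K n)"
  have KS: "K (Suc n) = F (K n)" for n by (simp add: K_def)
  have Fmono: "X \<subseteq> Y \<Longrightarrow> F X \<subseteq> F Y" for X Y by (auto simp: F_def)
  have ax: "0 \<le> a * x" "a * x \<le> a" if "0 < a" "0 \<le> x" "x \<le> 1" for a x :: real
    using that by (simp_all add: mult_left_le)
  have "F (K 0) \<subseteq> K 0"
  proof
    fix p assume "p \<in> F (K 0)"
    then obtain x y where xy: "0 \<le> x" "x \<le> 1" "0 \<le> y" "y \<le> 1"
      and p: "p = (l * x, m * y) \<or> p = (m * x + 1 - m, l * y + 1 - l)"
      by (auto simp: F_def K_def T0_def T1_def)
    note bds = ax[OF lm(1) xy(1,2)] ax[OF lm(3) xy(3,4)] ax[OF lm(3) xy(1,2)] ax[OF lm(1) xy(3,4)] lm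
    have "0 \<le> fst p \<and> fst p \<le> 1 \<and> 0 \<le> snd p \<and> snd p \<le> 1"
      using p
    proof
      assume "p = (l * x, m * y)"
      then have "fst p = l * x" "snd p = m * y" by simp_all
      with bds show ?thesis by linarith
    next
      assume "p = (m * x + 1 - m, l * y + 1 - l)"
      then have "fst p = m * x + 1 - m" "snd p = l * y + 1 - l" by simp_all
      with bds show ?thesis by linarith
    qed
    then show "p \<in> K 0" by (simp add: K_def mem_Times_iff)
  qed
  then have step: "K (Suc n) \<subseteq> K n" for n
    by (induction n) (auto simp: KS dest: Fmono)
  have dec: "K n \<subseteq> K k" if "k \<le> n" for k n
    using lift_Suc_antimono_le[of K, OF step that] .
  have cont: "continuous_on X (T0 l m)" "continuous_on X (T1 l m)" for X
    unfolding T0_def T1_def case_prod_beta by (intro continuous_intros)+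
  have comp: "compact (K n)" for n
  proof (induction n)
    case 0 show ?case by (simp add: K_def compact_Times)
  next
    case (Suc n)
    then show ?case
      unfolding KS F_def by (intro compact_Un compact_continuous_image cont)
  qed
  have ne: "K n \<noteq> {}" for n
    by (induction n) (auto simp: KS F_def, simp add: K_def)
  have "A \<noteq> {}"
    unfolding A_def using compact_nest[of K] comp ne dec by blast
  moreover have "compact A"
    unfolding A_def using comp by (intro compact_Inter) auto
  moreover have "T0 l m ` A \<union> T1 l m ` A \<subseteq> A"
  proof -
    have "F A \<subseteq> K n" for n
      using Fmono[of A "K n"] step[of n] by (auto simp: KS A_def)
    then show ?thesis by (auto simp: A_def F_def)
  qed
  moreover have "A \<subseteq> T0 l m ` A \<union> T1 l m ` A"
  proof
    fix p assume p: "p \<in> A"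
    have inj: "inj (T0 l m)" "inj (T1 l m)"
      using lm by (auto simp: inj_def T0_def T1_def)
    show "p \<in> T0 l m ` A \<union> T1 l m ` A"
    proof (rule ccontr)
      assume n: "p \<notin> T0 l m ` A \<union> T1 l m ` A"
      have "T0 l m ` A = (\<Inter>i. T0 l m ` K i)" "T1 l m ` A = (\<Inter>i. T1 l m ` K i)"
        unfolding A_def using inj by (simp_all add: image_INT[where C=UNIV])
      with n have "p \<notin> (\<Inter>i. T0 l m ` K i)" "p \<notin> (\<Inter>i. T1 l m ` K i)"
        by (simp_all only: Un_iff de_Morgan_disj not_False_eq_True)
      then obtain i j where ij: "p \<notin> T0 l m ` K i" "p \<notin> T1 l m ` K j"
        unfolding INT_iff by blast
      have "p \<in> K (Suc (max i j))" using p by (auto simp: A_def)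
      moreover have "K (max i j) \<subseteq> K i" "K (max i j) \<subseteq> K j" by (auto intro!: dec)
      ultimately show False using ij unfolding KS F_def by blast
    qed
  qed
  ultimately show ?thesis unfolding is_attractor_def by blast
qed

theorem ex1_attractor:
  assumes "0 < l" "l < 1" "0 < m" "m < 1"
  shows "\<exists>!A. is_attractor l m A"
  using attractor_exists[OF assms] attractor_subset[OF assms] by blast

lemma is_attractor_attractor:
  assumes "0 < l" "l < 1" "0 < m" "m < 1"
  shows "is_attractor l m (attractor l m)"
  unfolding attractor_def by (rule theI'[OF ex1_attractor[OF assms]])

end

(* With c = (1-l)(1-m), the compositions T0 T1 and T1 T0 are homotheties of ratio lm whose
   translation parts differ by c(1,1). Enclosing both in T0 ... T1
   changes the direction: T0 T0 T1 T1 and T0 T1 T0 T1 are homotheties of ratio (lm)^2 that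
   differ by c(l,m).
   Hence the four compositions u T0 u' T1 with u, u' in {T0 T1, T1 T0} are homotheties of common
   ratio r = (lm)^3 whose translations are the corners of a nondegenerate parallelogram.
   As r >= 1/2, digits 0, 1 in base 1/r represent a whole interval along each of its sides, so
   the attractor contains a parallelogram. *)

theory Submission
  imports Defs
begin

text \<open>A point \<open>p\<close> of \<open>P\<close> at maximal distance from \<open>A\<close>
  is \<open>f q\<close> with \<open>q\<close> in \<open>P\<close>, and \<open>f\<close> shrinks the
  distance to \<open>A\<close> by the factor \<open>r\<close> because it maps \<open>A\<close> into
  itself. So the maximum is at most \<open>r\<close> times itself, hence zero. The map
  \<open>f\<close> may vary with \<open>p\<close>.\<close>

lemma self_covering_subset:
  fixes A P :: "'a::metric_space set"
  assumes A: "closed A" "A \<noteq> {}" and P: "compact P" and r: "0 < r" "r < 1"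
    and cover: "\<And>p. p \<in> P \<Longrightarrow> \<exists>q\<in>P. \<exists>f. p = f q \<and> f ` A \<subseteq> A \<and> (\<forall>x y. dist (f x) (f y) \<le> r * dist x y)"
  shows "P \<subseteq> A"
proof (cases "P = {}")
  case False
  have "continuous_on P (\<lambda>p. infdist p A)"
    by (intro continuous_intros)
  then obtain p where p: "p \<in> P" and pmax: "\<And>q. q \<in> P \<Longrightarrow> infdist q A \<le> infdist p A"
    using continuous_attains_sup[OF P False] by blast
  obtain q f where q: "q \<in> P" "p = f q" and f: "f ` A \<subseteq> A" "\<And>x y. dist (f x) (f y) \<le> r * dist x y"
    using cover[OF p] by blast
  have "infdist p A / r \<le> dist q a" if "a \<in> A" for a
  proof -
    have "infdist p A \<le> r * dist q a"
      unfolding q(2) using f that by (intro infdist_le2[of "f a"]) auto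
    then show ?thesis using r by (simp add: field_simps)
  qed
  then have "infdist p A / r \<le> infdist q A"
    using A(2) by (auto simp: infdist_notempty intro: cINF_greatest)
  also have "\<dots> \<le> infdist p A" by (rule pmax[OF q(1)])
  finally have "infdist p A \<le> r * infdist p A" using r by (simp add: field_simps)
  then have "(1 - r) * infdist p A \<le> 0" by (simp add: algebra_simps)
  then have "infdist p A \<le> 0" using r by (simp add: mult_le_0_iff)
  then have "infdist x A = 0" if "x \<in> P" for x
    using pmax[OF that] infdist_nonneg[of x A] by linarith
  then show ?thesis
    using in_closed_iff_infdist_zero[OF A] by blast
qed simp

text \<open>The images of \<open>{0..1 / (1 - r)}\<close> under multiplication by \<open>r\<close>,
  without and with adding 1, are \<open>{0..r / (1 - r)}\<close> and
  \<open>{1..1 / (1 - r)}\<close>. They leave no gap exactly because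
  \<open>1 / 2 \<le> r\<close>.\<close>

lemma digit_step:
  fixes r s :: real
  assumes r: "1 / 2 \<le> r" "r < 1" and s: "s \<in> {0..1 / (1 - r)}"
  shows "\<exists>e\<in>{0,1}. \<exists>s'\<in>{0..1 / (1 - r)}. s = r * s' + e"
proof (cases "s \<le> r / (1 - r)")
  case True
  then have "s / r \<in> {0..1 / (1 - r)}" "s = r * (s / r) + 0"
    using r s by (auto simp: field_simps)
  then show ?thesis by blast
next
  case False
  have "1 \<le> r / (1 - r)" using r by (simp add: field_simps)
  then have "1 \<le> s" using False by linarith
  then have "(s - 1) / r \<in> {0..1 / (1 - r)}" "s = r * ((s - 1) / r) + 1"
    using r s by (auto simp: field_simps)
  then show ?thesis by blast
qed

text \<open>Applying \<open>digit_step\<close> to both coordinates covers the parallelogram by its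
  four images under the homotheties in \<open>inv\<close>, so \<open>self_covering_subset\<close>
  applies.\<close>

lemma parallelogram_subset:
  fixes A :: "'a::real_normed_vector set"
  assumes A: "closed A" "A \<noteq> {}" and r: "1 / 2 \<le> r" "r < 1"
    and inv: "\<And>d e x. d \<in> {0,1} \<Longrightarrow> e \<in> {0,1} \<Longrightarrow> x \<in> A
      \<Longrightarrow> r *\<^sub>R x + a + d *\<^sub>R v + e *\<^sub>R w \<in> A"
  shows "(\<lambda>(s, t). a /\<^sub>R (1 - r) + (s *\<^sub>R v + t *\<^sub>R w)) ` ({0..1 / (1 - r)} \<times> {0..1 / (1 - r)}) \<subseteq> A"
    (is "?g ` (?I \<times> ?I) \<subseteq> A")
proof (rule self_covering_subset[OF A])
  show "compact (?g ` (?I \<times> ?I))"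
    unfolding case_prod_beta
    by (intro compact_continuous_image compact_Times compact_Icc continuous_intros)
next
  fix p assume "p \<in> ?g ` (?I \<times> ?I)"
  then obtain s t where st: "s \<in> ?I" "t \<in> ?I" and p: "p = ?g (s, t)" by blast
  obtain d s' where d: "d \<in> {0,1}" "s' \<in> ?I" "s = r * s' + d"
    using digit_step[OF r st(1)] by blast
  obtain e t' where e: "e \<in> {0,1}" "t' \<in> ?I" "t = r * t' + e"
    using digit_step[OF r st(2)] by blast
  define f where "f x = r *\<^sub>R x + a + d *\<^sub>R v + e *\<^sub>R w" for x
  \<comment> \<open>The corner \<open>a /\<^sub>R (1 - r)\<close> is the fixed point of the
    homothety with digits \<open>d = e = 0\<close>.\<close>
  have "r * inverse (1 - r) + 1 = inverse (1 - r)" using r by (simp add: field_simps)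
  then have fixpt: "r *\<^sub>R (a /\<^sub>R (1 - r)) + a = a /\<^sub>R (1 - r)"
    by (metis scaleR_left_distrib scaleR_one scaleR_scaleR)
  have "f (?g (s', t')) = (r *\<^sub>R (a /\<^sub>R (1 - r)) + a) + (s *\<^sub>R v + t *\<^sub>R w)"
    unfolding f_def d(3) e(3) by (simp add: scaleR_add_right scaleR_add_left algebra_simps)
  then have "p = f (?g (s', t'))" by (simp only: p fixpt prod.case)
  moreover have "f ` A \<subseteq> A" using inv d(1) e(1) by (auto simp: f_def)
  moreover have "dist (f x) (f y) \<le> r * dist x y" for x y
    using r by (simp add: f_def dist_norm flip: scaleR_diff_right)
  ultimately show "\<exists>q\<in>?g ` (?I \<times> ?I). \<exists>f. p = f q \<and> f ` A \<subseteq> A \<and> (\<forall>x y. dist (f x) (f y) \<le> r * dist x y)"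
    using d(2) e(2) by blast
qed (use r in auto)

text \<open>A nonzero determinant makes the linear map onto the plane, hence open, so the image of
  the open square is open.\<close>

lemma interior_parallelogram:
  fixes v w c :: "real \<times> real"
  assumes det: "fst v * snd w \<noteq> fst w * snd v" and S: "0 < S"
  shows "interior ((\<lambda>(s, t). c + (s *\<^sub>R v + t *\<^sub>R w)) ` ({0..S} \<times> {0..S})) \<noteq> {}"
proof -
  define f where "f = (\<lambda>(s, t). s *\<^sub>R v + t *\<^sub>R w)"
  have lin: "linear f"
    by (rule linearI) (auto simp: f_def algebra_simps)
  have "surj f"
  proof (rule surjI)
    fix p :: "real \<times> real"
    let ?D = "fst v * snd w - fst w * snd v"
    have D: "?D \<noteq> 0" using det by simp
    \<comment> \<open>The preimage of \<open>p\<close> is given by Cramer's rule.\<close>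
    have "((fst p * snd w - fst w * snd p) / ?D) * fst v + ((fst v * snd p - fst p * snd v) / ?D) * fst w
        = fst p * ?D / ?D"
      by (simp add: algebra_simps flip: add_divide_distrib diff_divide_distrib)
    moreover have "((fst p * snd w - fst w * snd p) / ?D) * snd v + ((fst v * snd p - fst p * snd v) / ?D) * snd w
        = snd p * ?D / ?D"
      by (simp add: algebra_simps flip: add_divide_distrib diff_divide_distrib)
    ultimately show "f ((fst p * snd w - fst w * snd p) / ?D, (fst v * snd p - fst p * snd v) / ?D) = p"
      using D by (simp add: f_def prod_eq_iff)
  qed
  then have "open ((+) c ` f ` ({0<..<S} \<times> {0<..<S}))"
    by (intro open_translation open_surjective_linear_image[OF _ lin] open_Times open_greaterThanLessThan)
  moreover have "(+) c ` f ` ({0<..<S} \<times> {0<..<S})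
      \<subseteq> (\<lambda>(s, t). c + (s *\<^sub>R v + t *\<^sub>R w)) ` ({0..S} \<times> {0..S})"
    unfolding f_def by force
  ultimately have "(+) c ` f ` ({0<..<S} \<times> {0<..<S})
      \<subseteq> interior ((\<lambda>(s, t). c + (s *\<^sub>R v + t *\<^sub>R w)) ` ({0..S} \<times> {0..S}))"
    by (rule interior_maximal[rotated])
  moreover have "{0<..<S} \<noteq> {}" using S by simp
  ultimately show ?thesis by blast
qed

theorem theorem1p5:
  fixes l m :: real
  assumes "0 < l" and "l < m" and "m < 1"
    and "l + m > 1"
    and "l * m \<ge> 2 powr (- (1 / 6))"
  shows "interior (attractor l m) \<noteq> {}"
proof -
  define A where "A = attractor l m"
  have "is_attractor l m A"
    unfolding A_def using assms by (intro is_attractor_attractor) auto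
  then have A: "A \<noteq> {}" "closed A" and inv: "x \<in> A \<Longrightarrow> T0 l m x \<in> A" "x \<in> A \<Longrightarrow> T1 l m x \<in> A" for x
    unfolding is_attractor_def using compact_imp_closed by blast+
  define r where "r = (l * m) ^ 3"
  have lm: "0 < l * m" "l * m < 1"
    using assms mult_strict_mono[of l 1 m 1] by auto
  \<comment> \<open>The cube root of 1/2 is the value of \<open>l * m\<close> at which
    \<open>r\<close> equals 1/2.\<close>
  have "(2::real) powr (- (1 / 3)) \<le> 2 powr (- (1 / 6))" by simp
  also have "\<dots> \<le> l * m" by (rule assms(5))
  finally have "((2::real) powr (- (1 / 3))) ^ 3 \<le> r"
    unfolding r_def by (intro power_mono) auto
  moreover have "((2::real) powr (- (1 / 3))) ^ 3 = 1 / 2"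
    by (simp add: powr_minus powr_power field_simps)
  ultimately have r: "1 / 2 \<le> r" "r < 1"
    using lm by (auto simp: r_def power_less_one_iff)
  define c where "c = (1 - l) * (1 - m)"
  define v where "v = (c, c)"
  \<comment> \<open>The linear part of \<open>T0 \<circ> T1 \<circ> T0\<close>, which is
    \<open>l * m\<close> times \<open>diag(l, m)\<close>, applied to \<open>v\<close>.\<close>
  define w where "w = (l * m * c * l, l * m * c * m)"
  \<comment> \<open>Translation part of the word with both inner pairs equal to
    \<open>T0 \<circ> T1\<close>. Swapping its first two letters adds \<open>v\<close>; swapping the
    fourth and fifth adds \<open>w\<close>.\<close>
  define a where "a = (T0 l m \<circ> T1 l m \<circ> T0 l m \<circ> T0 l m \<circ> T1 l m \<circ> T1 l m) 0"
  have words: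
    "r *\<^sub>R x + a = T0 l m (T1 l m (T0 l m (T0 l m (T1 l m (T1 l m x)))))"
    "r *\<^sub>R x + a + v = T1 l m (T0 l m (T0 l m (T0 l m (T1 l m (T1 l m x)))))"
    "r *\<^sub>R x + a + w = T0 l m (T1 l m (T0 l m (T1 l m (T0 l m (T1 l m x)))))"
    "r *\<^sub>R x + a + v + w = T1 l m (T0 l m (T0 l m (T1 l m (T0 l m (T1 l m x)))))" for x
    by (cases x; simp add: r_def a_def v_def w_def c_def T0_def T1_def zero_prod_def;
        simp add: algebra_simps power3_eq_cube)+
  have corners: "r *\<^sub>R x + a \<in> A" "r *\<^sub>R x + a + v \<in> A"
    "r *\<^sub>R x + a + w \<in> A" "r *\<^sub>R x + a + v + w \<in> A"
    if "x \<in> A" for x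
    by (metis words inv that)+
  have "r *\<^sub>R x + a + d *\<^sub>R v + e *\<^sub>R w \<in> A" if "d \<in> {0,1}" "e \<in> {0,1}" "x \<in> A" for d e x
    using that(1,2) corners[OF that(3)] by auto
  from parallelogram_subset[OF A(2,1) r this]
  have "interior ((\<lambda>(s, t). a /\<^sub>R (1 - r) + (s *\<^sub>R v + t *\<^sub>R w))
      ` ({0..1 / (1 - r)} \<times> {0..1 / (1 - r)})) \<subseteq> interior A"
    by (rule interior_mono) auto
  \<comment> \<open>The two sides differ by \<open>l * m * c^2 * (m - l)\<close>, which is positive
    as \<open>l < m < 1\<close>.\<close>
  moreover have "fst v * snd w \<noteq> fst w * snd v"
    using assms lm by (auto simp: v_def w_def c_def)
  ultimately show ?thesis
    using interior_parallelogram[of v w "1 / (1 - r)" "a /\<^sub>R (1 - r)"] r by (auto simp: A_def)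
qed

end
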